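(* Let $p$ be a prime and let a finite abelian group $G$ isomorphic to $(\mathbb{Z}/p)^k$ act on a polynomial ring $R=\mathbb{C}[x_1,x_2,\ldots,x_n]$ with $k<n$, the action being linear, diagonal and with trivial kernel. Then the entire minimal generating set for $R^G$ can be constructed using $n-k$ seed invariants.
   Context: The action is by $\mathbb{C}$-algebra automorphisms: fix generators $g_1,\ldots,g_k$ of $G\cong(\mathbb{Z}/p)^k$ (the standard ones) and a primitive $p$-th root of unity $\mu_p\in\mathbb{C}$; then $g_i\cdot x_j=\mu_p^{w_{ij}}x_j$ with $w_{ij}\in\mathbb{Z}/p$, and $W=[w_{ij}]$ is the ($k\times n$) weight matrix. Trivial kernel means that only the identity of $G$ acts trivially. $R^G=\{f\in R: g\cdot f=f \text{ for all } g\in G\}$ is the invariant ring; since the action is diagonal, it has a minimal generating set as a $\mathbb{C}$-algebra consisting of monomials, and this is the minimal generating set meant. For $\alpha\in\mathbb{Z}_{\ge 0}^n$ write $x^\alpha=x_1^{\alpha_1}\cdots x_n^{\alpha_n}$. Seed invariants (seeds) are the members of a collection of invariant monomials whose exponent vectors, taken modulo $p$, generate the kernel of $W$ over $\mathbb{Z}/p$. "Constructed" is meant in the informal sense of growing the seeds: one takes combinations of the seeds (integer combinations of their exponent vectors), reduces the exponents modulo $p$, and uses these together with the pure powers $x_1^p,\ldots,x_n^p$, which are always invariant, to obtain the minimal generators. *)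

theory Defs
  imports
    Complex_Main
    "HOL-Library.Poly_Mapping"
    "HOL-Number_Theory.Cong"
    "HOL-Computational_Algebra.Primes"
    "HOL-Algebra.Group_Action"
    "HOL-Algebra.Product_Groups"
begin

text \<open>
  Polynomials are elements of the monoid algebra of finitely supported exponent vectors over
  the complex numbers. The variables \<open>x\<^sub>1, \<dots>, x\<^sub>n\<close> carry the indices \<open>0, \<dots>, n - 1\<close>, and
  \<open>poly_ring n\<close> is the set of polynomials involving only these.
\<close>

type_synonym exponent = "nat \<Rightarrow>\<^sub>0 nat"
type_synonym cpoly = "exponent \<Rightarrow>\<^sub>0 complex"

definition mono_of :: "exponent \<Rightarrow> cpoly" where
  "mono_of \<alpha> = Poly_Mapping.single \<alpha> 1"

definition pvar :: "nat \<Rightarrow> cpoly" where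
  "pvar j = mono_of (Poly_Mapping.single j 1)"

definition scalar :: "complex \<Rightarrow> cpoly" where
  "scalar c = Poly_Mapping.single 0 c"

definition poly_ring :: "nat \<Rightarrow> cpoly set" where
  "poly_ring n = {f. \<forall>\<alpha>\<in>Poly_Mapping.keys f. Poly_Mapping.keys \<alpha> \<subseteq> {..<n}}"

inductive_set alg_span :: "cpoly set \<Rightarrow> cpoly set" for A :: "cpoly set" where
  scalar: "scalar c \<in> alg_span A"
| gen: "a \<in> A \<Longrightarrow> a \<in> alg_span A"
| add: "a \<in> alg_span A \<Longrightarrow> b \<in> alg_span A \<Longrightarrow> a + b \<in> alg_span A"
| mult: "a \<in> alg_span A \<Longrightarrow> b \<in> alg_span A \<Longrightarrow> a * b \<in> alg_span A"

text \<open>Bijectivity of each \<open>\<phi> g\<close> on \<open>poly_ring n\<close> is part of \<open>group_action\<close>.\<close>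

definition algebra_action ::
  "('g, 'b) monoid_scheme \<Rightarrow> nat \<Rightarrow> ('g \<Rightarrow> cpoly \<Rightarrow> cpoly) \<Rightarrow> bool" where
  "algebra_action G n \<phi> \<longleftrightarrow>
     group_action G (poly_ring n) \<phi> \<and>
     (\<forall>g\<in>carrier G.
        (\<forall>c. \<phi> g (scalar c) = scalar c) \<and>
        (\<forall>a\<in>poly_ring n. \<forall>b\<in>poly_ring n. \<phi> g (a + b) = \<phi> g a + \<phi> g b) \<and>
        (\<forall>a\<in>poly_ring n. \<forall>b\<in>poly_ring n. \<phi> g (a * b) = \<phi> g a * \<phi> g b))"

definition linear_diagonal ::
  "('g, 'b) monoid_scheme \<Rightarrow> nat \<Rightarrow> ('g \<Rightarrow> cpoly \<Rightarrow> cpoly) \<Rightarrow> bool" where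
  "linear_diagonal G n \<phi> \<longleftrightarrow>
     (\<forall>g\<in>carrier G. \<forall>j<n. \<exists>c. \<phi> g (pvar j) = scalar c * pvar j)"

definition invariant_ring ::
  "('g, 'b) monoid_scheme \<Rightarrow> nat \<Rightarrow> ('g \<Rightarrow> cpoly \<Rightarrow> cpoly) \<Rightarrow> cpoly set" where
  "invariant_ring G n \<phi> = {f \<in> poly_ring n. \<forall>g\<in>carrier G. \<phi> g f = f}"

definition primitive_root_of_unity :: "nat \<Rightarrow> complex \<Rightarrow> bool" where
  "primitive_root_of_unity p \<mu> \<longleftrightarrow> \<mu> ^ p = 1 \<and> (\<forall>m. 0 < m \<and> m < p \<longrightarrow> \<mu> ^ m \<noteq> 1)"

abbreviation elementary_group :: "nat \<Rightarrow> nat \<Rightarrow> (nat \<Rightarrow> int) monoid" where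
  "elementary_group p k \<equiv> product_group {..<k} (\<lambda>_. integer_mod_group p)"

definition unit_vector :: "nat \<Rightarrow> nat \<Rightarrow> nat \<Rightarrow> int" where
  "unit_vector k i = (\<lambda>l\<in>{..<k}. if l = i then 1 else 0)"

text \<open>
  \<open>h\<close> is an isomorphism from \<open>elementary_group p k\<close> to the acting group, so that the
  \<open>h (unit_vector k i)\<close> are its standard generators. An entry of the weight matrix is
  represented by its residue in \<open>{0..<p}\<close>.
\<close>

definition weight_matrix ::
  "nat \<Rightarrow> nat \<Rightarrow> complex \<Rightarrow> ((nat \<Rightarrow> int) \<Rightarrow> 'g) \<Rightarrow> ('g \<Rightarrow> cpoly \<Rightarrow> cpoly) \<Rightarrow> nat \<Rightarrow> nat \<Rightarrow> nat" where
  "weight_matrix p k \<mu> h \<phi> i j =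
     (THE a. a < p \<and> \<phi> (h (unit_vector k i)) (pvar j) = scalar (\<mu> ^ a) * pvar j)"

text \<open>
  Vectors over \<open>\<int>/p\<close> are represented by integer vectors up to congruence modulo \<open>p\<close>
  in the first \<open>n\<close> entries.
\<close>

definition in_kernel_mod :: "nat \<Rightarrow> nat \<Rightarrow> nat \<Rightarrow> (nat \<Rightarrow> nat \<Rightarrow> nat) \<Rightarrow> (nat \<Rightarrow> int) \<Rightarrow> bool" where
  "in_kernel_mod p k n W v \<longleftrightarrow> (\<forall>i<k. [(\<Sum>j<n. int (W i j) * v j) = 0] (mod int p))"

definition int_combination :: "exponent set \<Rightarrow> (exponent \<Rightarrow> int) \<Rightarrow> nat \<Rightarrow> int" where
  "int_combination S c j = (\<Sum>\<beta>\<in>S. c \<beta> * int (Poly_Mapping.lookup \<beta> j))"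

definition generates_kernel_mod ::
  "nat \<Rightarrow> nat \<Rightarrow> nat \<Rightarrow> (nat \<Rightarrow> nat \<Rightarrow> nat) \<Rightarrow> exponent set \<Rightarrow> bool" where
  "generates_kernel_mod p k n W S \<longleftrightarrow>
     (\<forall>v. in_kernel_mod p k n W v \<longleftrightarrow>
          (\<exists>c. \<forall>j<n. [v j = int_combination S c j] (mod int p)))"

text \<open>Seed monomials are given by the finite set \<open>S\<close> of their exponent vectors.\<close>

definition seed_invariants ::
  "('g, 'b) monoid_scheme \<Rightarrow> nat \<Rightarrow> nat \<Rightarrow> nat \<Rightarrow> ('g \<Rightarrow> cpoly \<Rightarrow> cpoly) \<Rightarrow>
     (nat \<Rightarrow> nat \<Rightarrow> nat) \<Rightarrow> exponent set \<Rightarrow> bool" where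
  "seed_invariants G p k n \<phi> W S \<longleftrightarrow>
     finite S \<and> mono_of ` S \<subseteq> invariant_ring G n \<phi> \<and> generates_kernel_mod p k n W S"

definition reduced_combinations :: "nat \<Rightarrow> nat \<Rightarrow> exponent set \<Rightarrow> cpoly set" where
  "reduced_combinations p n S =
     {mono_of \<alpha> | \<alpha>. Poly_Mapping.keys \<alpha> \<subseteq> {..<n} \<and>
        (\<exists>c. \<forall>j<n. int (Poly_Mapping.lookup \<alpha> j) = int_combination S c j mod int p)}"

definition grown_monomials :: "nat \<Rightarrow> nat \<Rightarrow> exponent set \<Rightarrow> cpoly set" where
  "grown_monomials p n S = reduced_combinations p n S \<union> {pvar j ^ p | j. j < n}"

text \<open>
  The construction from the seeds keeps those grown monomials that are not polynomials in
  the remaining ones. In particular it discards \<open>1\<close>, the combination with zero coefficients.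
\<close>

definition constructed_from_seeds :: "nat \<Rightarrow> nat \<Rightarrow> exponent set \<Rightarrow> cpoly set" where
  "constructed_from_seeds p n S =
     {m \<in> grown_monomials p n S. m \<notin> alg_span (grown_monomials p n S - {m})}"

definition minimal_monomial_generators ::
  "('g, 'b) monoid_scheme \<Rightarrow> nat \<Rightarrow> ('g \<Rightarrow> cpoly \<Rightarrow> cpoly) \<Rightarrow> cpoly set \<Rightarrow> bool" where
  "minimal_monomial_generators G n \<phi> M \<longleftrightarrow>
     M \<subseteq> range mono_of \<and>
     alg_span M = invariant_ring G n \<phi> \<and>
     (\<forall>N. N \<subset> M \<longrightarrow> alg_span N \<noteq> invariant_ring G n \<phi>)"

end

theory Submission
  imports Defs
begin

text \<open>
  Diagonalisation reduces the theorem to a statement about exponent vectors. A group element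
  multiplies \<open>x\<^sup>\<alpha>\<close> by a power of the primitive root of unity whose exponent is a linear form in
  \<open>\<alpha>\<close>, so the invariant ring is spanned by the monomials \<open>x\<^sup>\<alpha>\<close> with \<open>W \<alpha> = 0\<close> modulo \<open>p\<close>
  (\<open>invariant_ring_eq\<close>). These \<open>\<alpha>\<close> form a submonoid \<open>A\<close> of the nonnegative integer vectors.

  In such a monoid every element is a sum of atoms, by induction on the degree, and every
  generating set contains the atoms. The monomials whose exponents are atoms of \<open>A\<close> therefore
  form the only minimal monomial generating set (\<open>minimal_monomial_generators_iff\<close>), and they
  are also what survives when redundant elements are discarded from an arbitrary monomial
  generating set (\<open>irredundant_monomials\<close>).

  It remains to see that the monomials grown from the seeds generate the invariant ring, and
  that \<open>n - k\<close> seeds are enough. For the first, subtracting \<open>p\<close> repeatedly from large entries of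
  \<open>\<alpha> \<in> A\<close> splits off pure powers and leaves a kernel vector with entries below \<open>p\<close>, which is a
  combination of the seeds reduced modulo \<open>p\<close> (\<open>monoid_hull_grown_exponents\<close>,
  \<open>grown_monomials_eq\<close>). For the second, faithfulness says that the \<open>k\<close> rows of \<open>W\<close> are linearly
  independent modulo \<open>p\<close> (\<open>independent_rows_if_faithful\<close>), so that the kernel of \<open>W\<close> is generated
  by \<open>n - k\<close> vectors (\<open>kernel_mod_generators\<close>); these lift to distinct exponent vectors.
\<close>

section \<open>Linear algebra modulo a prime\<close>

text \<open>
  Vectors over the field with \<open>p\<close> elements are integer vectors read modulo \<open>p\<close> in their first
  \<open>n\<close> entries, so that all linear algebra below consists of congruences.
\<close>

definition pairing :: "nat \<Rightarrow> (nat \<Rightarrow> int) \<Rightarrow> (nat \<Rightarrow> int) \<Rightarrow> int" where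
  "pairing n w x = (\<Sum>j<n. w j * x j)"

lemma pairing_cong_right:
  assumes "\<And>j. j < n \<Longrightarrow> [x j = y j] (mod m)"
  shows "[pairing n w x = pairing n w y] (mod m)"
  unfolding pairing_def using assms by (intro cong_sum cong_mult) auto

lemma pairing_diff_right:
  "pairing n w (\<lambda>j. x j - a * y j) = pairing n w x - a * pairing n w y"
  by (simp add: pairing_def algebra_simps sum_subtractf sum_distrib_left)

lemma pairing_scale_right: "pairing n w (\<lambda>j. a * x j) = a * pairing n w x"
  by (simp add: pairing_def algebra_simps sum_distrib_left)

lemma pairing_add_right:
  "pairing n w (\<lambda>j. x j + y j) = pairing n w x + pairing n w y"
  by (simp add: pairing_def algebra_simps sum.distrib)

lemma pairing_sum_right:
  "pairing n w (\<lambda>j. \<Sum>i\<in>I. a i * u i j) = (\<Sum>i\<in>I. a i * pairing n w (u i))"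
proof -
  have "pairing n w (\<lambda>j. \<Sum>i\<in>I. a i * u i j) = (\<Sum>j<n. \<Sum>i\<in>I. a i * (w j * u i j))"
    by (simp add: pairing_def sum_distrib_left mult.left_commute)
  also have "\<dots> = (\<Sum>i\<in>I. \<Sum>j<n. a i * (w j * u i j))"
    by (rule sum.swap)
  finally show ?thesis
    by (simp add: pairing_def sum_distrib_left)
qed

lemma pairing_unit_right: "j < n \<Longrightarrow> pairing n w (\<lambda>l. if l = j then 1 else 0) = w j"
  by (simp add: pairing_def if_distrib cong: if_cong)

definition independent_rows_mod :: "nat \<Rightarrow> nat \<Rightarrow> nat \<Rightarrow> (nat \<Rightarrow> nat \<Rightarrow> int) \<Rightarrow> bool" where
  "independent_rows_mod p k n w \<longleftrightarrow>
     (\<forall>a. (\<forall>j<n. [(\<Sum>i<k. a i * w i j) = 0] (mod int p)) \<longrightarrow> (\<forall>i<k. [a i = 0] (mod int p)))"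

lemma independent_rows_mod_SucD:
  assumes "independent_rows_mod p (Suc k) n w"
  shows "independent_rows_mod p k n w"
  unfolding independent_rows_mod_def
proof (intro allI impI)
  fix a i
  assume a: "\<forall>j<n. [(\<Sum>i<k. a i * w i j) = 0] (mod int p)" and "i < k"
  have "(\<Sum>i<Suc k. (a(k := 0)) i * w i j) = (\<Sum>i<k. a i * w i j)" for j
    by (simp add: sum.lessThan_Suc)
  with a have "\<forall>j<n. [(\<Sum>i<Suc k. (a(k := 0)) i * w i j) = 0] (mod int p)"
    by presburger
  with assms have "\<forall>i<Suc k. [(a(k := 0)) i = 0] (mod int p)"
    unfolding independent_rows_mod_def by blast
  then have "[(a(k := 0)) i = 0] (mod int p)"
    using \<open>i < k\<close> less_SucI by blast
  then show "[a i = 0] (mod int p)"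
    using \<open>i < k\<close> by simp
qed

text \<open>
  A spanning family of the whole space that is adapted to functionals \<open>w\<^sub>i\<close> (and a basis once
  \<open>L\<close> has \<open>n - k\<close> elements): the vectors
  \<open>u\<^sub>i\<close> are dual to the functionals and the vectors \<open>v\<^sub>l\<close> lie in their common kernel. The
  coordinate of \<open>x\<close> along \<open>u\<^sub>i\<close> is then forced to be \<open>w\<^sub>i(x)\<close>, which makes it evident that
  the \<open>v\<^sub>l\<close> span the common kernel. Carrying the dual vectors along allows an induction on the
  number of functionals without a theory of dimension.
\<close>

definition adapted_basis_mod ::
  "nat \<Rightarrow> nat \<Rightarrow> nat \<Rightarrow> (nat \<Rightarrow> nat \<Rightarrow> int) \<Rightarrow> (nat \<Rightarrow> nat \<Rightarrow> int) \<Rightarrow> nat set \<Rightarrow> (nat \<Rightarrow> nat \<Rightarrow> int) \<Rightarrow> bool"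
where
  "adapted_basis_mod p k n w u L v \<longleftrightarrow>
     (\<forall>i<k. \<forall>l<k. [pairing n (w i) (u l) = (if i = l then 1 else 0)] (mod int p)) \<and>
     (\<forall>i<k. \<forall>l\<in>L. [pairing n (w i) (v l) = 0] (mod int p)) \<and>
     (\<forall>x. \<exists>c. \<forall>j<n.
        [x j = (\<Sum>i<k. pairing n (w i) x * u i j) + (\<Sum>l\<in>L. c l * v l j)] (mod int p))"

text \<open>
  One step of Gaussian elimination. If the new functional \<open>r\<close> vanished on every \<open>v\<^sub>l\<close>, then
  expanding the standard basis vectors would give \<open>r = \<Sum>\<^sub>i r(u\<^sub>i) w\<^sub>i\<close>, against independence.
  So some \<open>r(v\<^sub>q)\<close> is invertible modulo \<open>p\<close>; a multiple of \<open>v\<^sub>q\<close> becomes the new dual vector, and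
  subtracting suitable multiples of it from all other vectors makes \<open>r\<close> vanish on them. The
  earlier functionals do not notice, because they vanish on \<open>v\<^sub>q\<close>.
\<close>

lemma adapted_basis_mod_step:
  assumes p: "prime p"
    and ind: "independent_rows_mod p (Suc k) n w"
    and bas: "adapted_basis_mod p k n w u L v"
    and L: "finite L"
  shows "\<exists>q\<in>L. \<exists>u' v'. adapted_basis_mod p (Suc k) n w u' (L - {q}) v'"
proof -
  define r where "r = pairing n (w k)"
  note r_cong = pairing_cong_right[of n _ _ "int p" "w k", folded r_def]
  have dual: "[pairing n (w i) (u l) = (if i = l then 1 else 0)] (mod int p)" if "i < k" "l < k" for i l
    using bas that by (simp add: adapted_basis_mod_def)
  have ker: "[pairing n (w i) (v l) = 0] (mod int p)" if "i < k" "l \<in> L" for i l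
    using bas that by (simp add: adapted_basis_mod_def)
  have decomp: "\<exists>c. \<forall>j<n.
        [x j = (\<Sum>i<k. pairing n (w i) x * u i j) + (\<Sum>l\<in>L. c l * v l j)] (mod int p)" for x
    using bas by (auto simp add: adapted_basis_mod_def)
  have r_decomp: "[r x = (\<Sum>i<k. pairing n (w i) x * r (u i)) + (\<Sum>l\<in>L. c l * r (v l))] (mod int p)"
    if "\<forall>j<n. [x j = (\<Sum>i<k. pairing n (w i) x * u i j) + (\<Sum>l\<in>L. c l * v l j)] (mod int p)" for x c
    using r_cong[of x "\<lambda>j. (\<Sum>i<k. pairing n (w i) x * u i j) + (\<Sum>l\<in>L. c l * v l j)"] that
    by (simp add: r_def pairing_add_right pairing_sum_right)
  obtain q where q: "q \<in> L" "\<not> [r (v q) = 0] (mod int p)"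
  proof (rule ccontr)
    assume "\<not> thesis"
    with that have r0: "[r (v l) = 0] (mod int p)" if "l \<in> L" for l
      using that by blast
    \<comment> \<open>the coefficients of the relation \<open>r - \<Sum>\<^sub>i r(u\<^sub>i) w\<^sub>i = 0\<close>\<close>
    define a where "a = (\<lambda>i. if i = k then 1 else - r (u i))"
    have "[(\<Sum>i<Suc k. a i * w i j) = 0] (mod int p)" if j: "j < n" for j
    proof -
      define e :: "nat \<Rightarrow> int" where "e = (\<lambda>l. if l = j then 1 else 0)"
      obtain c where c: "\<forall>j<n. [e j = (\<Sum>i<k. pairing n (w i) e * u i j) + (\<Sum>l\<in>L. c l * v l j)] (mod int p)"
        using decomp by blast
      have "[(\<Sum>l\<in>L. c l * r (v l)) = (\<Sum>l\<in>L. c l * 0)] (mod int p)"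
        using r0 by (intro cong_sum cong_mult) simp_all
      then have "[(\<Sum>i<k. pairing n (w i) e * r (u i)) + (\<Sum>l\<in>L. c l * r (v l))
                 = (\<Sum>i<k. pairing n (w i) e * r (u i)) + (\<Sum>l\<in>L. c l * 0)] (mod int p)"
        by (rule cong_add[OF cong_refl])
      from cong_trans[OF r_decomp[OF c] this]
      have "[r e = (\<Sum>i<k. pairing n (w i) e * r (u i))] (mod int p)"
        by simp
      moreover have "pairing n (w i) e = w i j" for i
        using j by (simp add: e_def pairing_unit_right)
      ultimately have "[w k j = (\<Sum>i<k. w i j * r (u i))] (mod int p)"
        by (simp add: r_def)
      then have "[w k j - (\<Sum>i<k. w i j * r (u i)) = 0] (mod int p)"
        by (simp add: cong_diff_iff_cong_0)
      moreover have "(\<Sum>i<Suc k. a i * w i j) = w k j - (\<Sum>i<k. w i j * r (u i))"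
        by (simp add: a_def sum.lessThan_Suc sum_negf mult.commute)
      ultimately show ?thesis by simp
    qed
    then have "[a k = 0] (mod int p)"
      using ind by (simp add: independent_rows_mod_def)
    then have "int p dvd 1"
      by (simp add: a_def cong_0_iff)
    then show False
      using p by (metis int_dvd_int_iff nat_dvd_1_iff_1 not_prime_1 of_nat_1)
  qed
  have "coprime (int p) (r (v q))"
    using q(2) p by (intro prime_imp_coprime) (auto simp: cong_0_iff)
  then obtain t where t: "[r (v q) * t = 1] (mod int p)"
    using cong_solve_coprime_int[of "r (v q)" "int p"] by (auto simp: coprime_commute)
  define uk where "uk = (\<lambda>j. t * v q j)"
  define u' where "u' = (\<lambda>i j. if i = k then uk j else u i j - r (u i) * uk j)"
  define v' where "v' = (\<lambda>l j. v l j - r (v l) * uk j)"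
  have r_uk: "[r uk = 1] (mod int p)"
    using t by (simp add: r_def uk_def pairing_scale_right mult.commute)
  have w_uk: "[pairing n (w i) uk = 0] (mod int p)" if "i < k" for i
    using cong_mult[OF cong_refl ker[OF that q(1)], of t] by (simp add: uk_def pairing_scale_right)
  have kill: "[r (\<lambda>j. x j - r x * uk j) = 0] (mod int p)" for x
  proof -
    have "[r x - r x * r uk = r x - r x * 1] (mod int p)"
      by (intro cong_diff cong_mult r_uk) auto
    then show ?thesis by (simp add: r_def pairing_diff_right)
  qed
  have keep: "[pairing n (w i) (\<lambda>j. x j - a * uk j) = pairing n (w i) x] (mod int p)" if "i < k" for i x a
  proof -
    have "[pairing n (w i) x - a * pairing n (w i) uk = pairing n (w i) x - a * 0] (mod int p)"
      by (intro cong_diff cong_mult w_uk that) auto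
    then show ?thesis by (simp add: pairing_diff_right)
  qed
  have "adapted_basis_mod p (Suc k) n w u' (L - {q}) v'"
    unfolding adapted_basis_mod_def
  proof (intro conjI allI impI ballI)
    fix i l assume "i < Suc k" "l < Suc k"
    then consider "i < k" "l < k" | "i < k" "l = k" | "i = k" "l < k" | "i = k" "l = k"
      by linarith
    then show "[pairing n (w i) (u' l) = (if i = l then 1 else 0)] (mod int p)"
    proof cases
      case 1
      then show ?thesis
        using cong_trans[OF keep dual] by (simp add: u'_def)
    next
      case 2
      then show ?thesis using w_uk by (simp add: u'_def)
    next
      case 3
      then show ?thesis using kill[of "u l"] by (simp add: u'_def r_def)
    next
      case 4
      then show ?thesis using r_uk by (simp add: u'_def r_def)
    qed
  next
    fix i l assume "i < Suc k" "l \<in> L - {q}"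
    then consider "i < k" | "i = k" by linarith
    then show "[pairing n (w i) (v' l) = 0] (mod int p)"
    proof cases
      case 1
      then show ?thesis
        using cong_trans[OF keep ker] \<open>l \<in> L - {q}\<close> by (simp add: v'_def)
    next
      case 2
      then show ?thesis using kill[of "v l"] by (simp add: v'_def r_def)
    qed
  next
    fix x
    obtain c where c: "\<forall>j<n. [x j = (\<Sum>i<k. pairing n (w i) x * u i j) + (\<Sum>l\<in>L. c l * v l j)] (mod int p)"
      using decomp by blast
    \<comment> \<open>the coefficients \<open>c\<close> can be kept: the corrections add up to \<open>r(x)\<close> times the new dual vector\<close>
    define s where "s = (\<Sum>i<k. pairing n (w i) x * r (u i)) + (\<Sum>l\<in>L. c l * r (v l))"
    have rs: "[s = r x] (mod int p)"
      using r_decomp[OF c] by (simp add: s_def cong_sym)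
    have "[x j = (\<Sum>i<Suc k. pairing n (w i) x * u' i j) + (\<Sum>l\<in>L - {q}. c l * v' l j)] (mod int p)"
      if j: "j < n" for j
    proof -
      have 1: "(\<Sum>i<k. pairing n (w i) x * u i j)
          = (\<Sum>i<k. pairing n (w i) x * u' i j) + (\<Sum>i<k. pairing n (w i) x * r (u i)) * uk j"
        by (simp add: u'_def algebra_simps sum_distrib_left sum_distrib_right sum_subtractf)
      have 2: "(\<Sum>l\<in>L. c l * v l j) = (\<Sum>l\<in>L. c l * v' l j) + (\<Sum>l\<in>L. c l * r (v l)) * uk j"
        by (simp add: v'_def algebra_simps sum_distrib_left sum_distrib_right sum_subtractf)
      have 3: "(\<Sum>l\<in>L. c l * v' l j) = c q * v' q j + (\<Sum>l\<in>L - {q}. c l * v' l j)"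
        using L q(1) by (simp add: sum.remove)
      have "[v q j - r (v q) * (t * v q j) = v q j - 1 * v q j] (mod int p)"
        using t by (subst mult.assoc[symmetric]) (intro cong_diff cong_mult, auto)
      then have 4: "[v' q j = 0] (mod int p)"
        by (simp add: v'_def uk_def)
      have 5: "[(\<Sum>i<k. pairing n (w i) x * u' i j) + (c q * v' q j + (\<Sum>l\<in>L - {q}. c l * v' l j)) + s * uk j
          = (\<Sum>i<k. pairing n (w i) x * u' i j) + (c q * 0 + (\<Sum>l\<in>L - {q}. c l * v' l j)) + r x * uk j] (mod int p)"
        by (intro cong_add cong_mult 4 rs) auto
      have 6: "(\<Sum>i<k. pairing n (w i) x * u i j) + (\<Sum>l\<in>L. c l * v l j) =
         (\<Sum>i<k. pairing n (w i) x * u' i j) + (c q * v' q j + (\<Sum>l\<in>L - {q}. c l * v' l j)) + s * uk j"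
        unfolding 1 2 3 s_def by (simp add: algebra_simps)
      have 7: "(\<Sum>i<Suc k. pairing n (w i) x * u' i j) + (\<Sum>l\<in>L - {q}. c l * v' l j) =
         (\<Sum>i<k. pairing n (w i) x * u' i j) + (c q * 0 + (\<Sum>l\<in>L - {q}. c l * v' l j)) + r x * uk j"
        by (simp add: u'_def sum.lessThan_Suc r_def)
      show ?thesis
        unfolding 7 by (rule cong_trans[OF c[rule_format, OF j, unfolded 6] 5])
    qed
    then show "\<exists>c. \<forall>j<n.
        [x j = (\<Sum>i<Suc k. pairing n (w i) x * u' i j) + (\<Sum>l\<in>L - {q}. c l * v' l j)] (mod int p)"
      by blast
  qed
  then show ?thesis using q(1) by blast
qed

lemma exists_adapted_basis_mod:
  assumes "prime p" and "independent_rows_mod p k n w"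
  shows "\<exists>u L v. finite L \<and> card L + k = n \<and> adapted_basis_mod p k n w u L v"
  using assms(2)
proof (induction k)
  case 0
  have "adapted_basis_mod p 0 n w u {..<n} (\<lambda>l j. if l = j then 1 else 0)" for u
    unfolding adapted_basis_mod_def
  proof (intro conjI allI)
    fix x :: "nat \<Rightarrow> int"
    show "\<exists>c. \<forall>j<n. [x j = (\<Sum>i<0. pairing n (w i) x * u i j)
        + (\<Sum>l<n. c l * (if l = j then 1 else 0))] (mod int p)"
      by (rule exI[of _ x]) (simp add: if_distrib cong: if_cong)
  qed auto
  then show ?case
    by (metis add.right_neutral card_lessThan finite_lessThan)
next
  case (Suc k)
  then obtain u L v where L: "finite L" "card L + k = n" "adapted_basis_mod p k n w u L v"
    using independent_rows_mod_SucD by blast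
  then obtain q u' v' where q: "q \<in> L" "adapted_basis_mod p (Suc k) n w u' (L - {q}) v'"
    using adapted_basis_mod_step[OF assms(1) Suc.prems] by blast
  have "card (L - {q}) + Suc k = n"
    using L q(1) card_Suc_Diff1[of L q] by linarith
  then show ?case
    using L(1) q(2) by blast
qed

lemma kernel_mod_generators:
  assumes "prime p" and "independent_rows_mod p k n w"
  obtains L :: "nat set" and v :: "nat \<Rightarrow> nat \<Rightarrow> int"
  where "finite L" "card L = n - k"
    and "\<And>x. (\<forall>i<k. [pairing n (w i) x = 0] (mod int p)) \<longleftrightarrow>
           (\<exists>c. \<forall>j<n. [x j = (\<Sum>l\<in>L. c l * v l j)] (mod int p))"
proof -
  obtain u L v where L: "finite L" "card L + k = n" and bas: "adapted_basis_mod p k n w u L v"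
    using exists_adapted_basis_mod[OF assms] by blast
  show thesis
  proof (rule that[of L v])
    fix x
    show "(\<forall>i<k. [pairing n (w i) x = 0] (mod int p)) \<longleftrightarrow>
           (\<exists>c. \<forall>j<n. [x j = (\<Sum>l\<in>L. c l * v l j)] (mod int p))"
    proof
      assume x: "\<forall>i<k. [pairing n (w i) x = 0] (mod int p)"
      obtain c where c: "\<forall>j<n. [x j = (\<Sum>i<k. pairing n (w i) x * u i j) + (\<Sum>l\<in>L. c l * v l j)] (mod int p)"
        using bas unfolding adapted_basis_mod_def by blast
      have drop: "[(\<Sum>i<k. pairing n (w i) x * u i j) + (\<Sum>l\<in>L. c l * v l j)
           = (\<Sum>i<k. 0 * u i j) + (\<Sum>l\<in>L. c l * v l j)] (mod int p)" for j
        using x by (intro cong_add cong_sum cong_mult) auto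
      have "[x j = (\<Sum>l\<in>L. c l * v l j)] (mod int p)" if "j < n" for j
        using cong_trans[OF c[rule_format, OF that] drop] by simp
      then show "\<exists>c. \<forall>j<n. [x j = (\<Sum>l\<in>L. c l * v l j)] (mod int p)"
        by blast
    next
      assume "\<exists>c. \<forall>j<n. [x j = (\<Sum>l\<in>L. c l * v l j)] (mod int p)"
      then obtain c where c: "\<forall>j<n. [x j = (\<Sum>l\<in>L. c l * v l j)] (mod int p)" ..
      show "\<forall>i<k. [pairing n (w i) x = 0] (mod int p)"
      proof (intro allI impI)
        fix i assume i: "i < k"
        have "[pairing n (w i) x = (\<Sum>l\<in>L. c l * pairing n (w i) (v l))] (mod int p)"
          using c pairing_cong_right[of n x "\<lambda>j. \<Sum>l\<in>L. c l * v l j"] by (simp add: pairing_sum_right)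
        also have "[(\<Sum>l\<in>L. c l * pairing n (w i) (v l)) = (\<Sum>l\<in>L. c l * 0)] (mod int p)"
          using bas i by (intro cong_sum cong_mult) (auto simp: adapted_basis_mod_def)
        finally show "[pairing n (w i) x = 0] (mod int p)" by simp
      qed
    qed
  qed (use L in auto)
qed

section \<open>Monoid algebras and atoms\<close>

text \<open>
  A subalgebra generated by monomials has as its basis the monomials whose exponents lie in the
  additive monoid generated by the given exponents. Questions about monomial generating sets
  are thereby questions about submonoids of a free commutative monoid.
\<close>

inductive_set monoid_hull :: "'a::comm_monoid_add set \<Rightarrow> 'a set" for B where
  zero: "0 \<in> monoid_hull B"
| add: "b \<in> B \<Longrightarrow> x \<in> monoid_hull B \<Longrightarrow> b + x \<in> monoid_hull B"

lemma monoid_hull_incl: "b \<in> B \<Longrightarrow> b \<in> monoid_hull B"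
  using monoid_hull.add[OF _ monoid_hull.zero] by fastforce

lemma monoid_hull_add: "x \<in> monoid_hull B \<Longrightarrow> y \<in> monoid_hull B \<Longrightarrow> x + y \<in> monoid_hull B"
  by (induction rule: monoid_hull.induct) (auto simp: add.assoc intro: monoid_hull.intros)

lemma monoid_hull_least:
  assumes "B \<subseteq> A" "0 \<in> A" "\<And>a b. a \<in> A \<Longrightarrow> b \<in> A \<Longrightarrow> a + b \<in> A"
  shows "monoid_hull B \<subseteq> A"
proof
  fix x assume "x \<in> monoid_hull B"
  then show "x \<in> A" by induction (use assms in auto)
qed

lemma monoid_hull_mono: "B \<subseteq> C \<Longrightarrow> monoid_hull B \<subseteq> monoid_hull C"
  by (rule monoid_hull_least) (auto intro: monoid_hull_incl monoid_hull.zero monoid_hull_add)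

lemma sum_monomials:
  fixes f :: "'a \<Rightarrow>\<^sub>0 'b::comm_monoid_add"
  shows "(\<Sum>\<alpha>\<in>Poly_Mapping.keys f. Poly_Mapping.single \<alpha> (Poly_Mapping.lookup f \<alpha>)) = f"
proof (rule poly_mapping_eqI)
  fix \<beta>
  show "Poly_Mapping.lookup (\<Sum>\<alpha>\<in>Poly_Mapping.keys f. Poly_Mapping.single \<alpha> (Poly_Mapping.lookup f \<alpha>)) \<beta> =
        Poly_Mapping.lookup f \<beta>"
    by (simp add: lookup_sum lookup_single when_def in_keys_iff)
qed

lemma scalar_mult_mono_of: "scalar c * mono_of \<alpha> = Poly_Mapping.single \<alpha> c"
  by (simp add: scalar_def mono_of_def mult_single)

lemma mono_of_add: "mono_of (\<alpha> + \<beta>) = mono_of \<alpha> * mono_of \<beta>"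
  by (simp add: mono_of_def mult_single)

lemma inj_mono_of: "inj mono_of"
  by (rule injI) (metis mono_of_def keys_single one_neq_zero singleton_inject)

lemma alg_span_monomials:
  "alg_span (mono_of ` B) = {f. Poly_Mapping.keys f \<subseteq> monoid_hull B}"
proof (intro equalityI subsetI CollectI)
  fix f x assume "f \<in> alg_span (mono_of ` B)" and "x \<in> Poly_Mapping.keys f"
  then show "x \<in> monoid_hull B"
  proof (induction arbitrary: x)
    case (scalar c)
    then have "x = 0" by (simp add: scalar_def split: if_splits)
    then show ?case by (simp add: monoid_hull.zero)
  next
    case (gen a)
    then show ?case by (auto simp: mono_of_def monoid_hull_incl)
  next
    case (add a b)
    then show ?case using Poly_Mapping.keys_add[of a b] by blast
  next
    case (mult a b)
    then show ?case using keys_mult[of a b] by (blast intro: monoid_hull_add)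
  qed
next
  fix f :: cpoly
  assume f: "f \<in> {f. Poly_Mapping.keys f \<subseteq> monoid_hull B}"
  have mono: "mono_of x \<in> alg_span (mono_of ` B)" if "x \<in> monoid_hull B" for x
    using that
  proof induction
    case zero
    have "mono_of 0 = scalar 1" by (simp add: mono_of_def scalar_def)
    then show ?case by (simp add: alg_span.scalar)
  next
    case (add b x)
    then show ?case by (simp add: mono_of_add alg_span.mult alg_span.gen)
  qed
  have "(\<Sum>\<alpha>\<in>K. Poly_Mapping.single \<alpha> (Poly_Mapping.lookup f \<alpha>)) \<in> alg_span (mono_of ` B)"
    if "finite K" "K \<subseteq> monoid_hull B" for K
    using that
  proof (induction K rule: finite_induct)
    case empty
    have "scalar 0 \<in> alg_span (mono_of ` B)" by (rule alg_span.scalar)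
    then show ?case by (simp add: scalar_def)
  next
    case (insert \<alpha> K)
    then show ?case
      by (simp add: scalar_mult_mono_of[symmetric] alg_span.add alg_span.mult alg_span.scalar mono)
  qed
  from this[of "Poly_Mapping.keys f"] show "f \<in> alg_span (mono_of ` B)"
    using f by (simp add: sum_monomials)
qed

lemma alg_span_monomials_eq_iff:
  "alg_span (mono_of ` B) = {f. Poly_Mapping.keys f \<subseteq> A} \<longleftrightarrow> monoid_hull B = A"
proof
  assume eq: "alg_span (mono_of ` B) = {f. Poly_Mapping.keys f \<subseteq> A}"
  have "x \<in> monoid_hull B \<longleftrightarrow> x \<in> A" for x
  proof -
    have "mono_of x \<in> alg_span (mono_of ` B) \<longleftrightarrow> mono_of x \<in> {f. Poly_Mapping.keys f \<subseteq> A}"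
      using eq by simp
    then show ?thesis unfolding alg_span_monomials by (simp add: mono_of_def)
  qed
  then show "monoid_hull B = A" by blast
qed (simp add: alg_span_monomials)

definition atoms :: "'a::comm_monoid_add set \<Rightarrow> 'a set" where
  "atoms A = {a \<in> A. a \<noteq> 0 \<and> (\<forall>b\<in>A. \<forall>c\<in>A. a = b + c \<longrightarrow> b = 0 \<or> c = 0)}"

text \<open>
  An atom cannot be assembled from other elements, so it belongs to every generating set.
\<close>

lemma atom_in_monoid_hull:
  assumes "a \<in> monoid_hull B" "a \<in> atoms A" "monoid_hull B \<subseteq> A"
  shows "a \<in> B"
  using assms(1,2)
proof induction
  case zero
  then show ?case by (simp add: atoms_def)
next
  case (add b x)
  have "b \<in> A" "x \<in> A"
    using add.hyps assms(3) monoid_hull_incl by auto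
  with add.prems have "b = 0 \<or> x = 0" by (auto simp: atoms_def)
  then show ?case using add by auto
qed

text \<open>
  A degree that is positive on nonzero elements makes decompositions into summands terminate,
  so that atoms generate. Together with \<open>atom_in_monoid_hull\<close> this determines the unique minimal generating set.
\<close>

locale graded_submonoid =
  fixes A :: "'a::comm_monoid_add set" and d :: "'a \<Rightarrow> nat"
  assumes zero_mem: "0 \<in> A"
    and add_mem: "\<And>a b. a \<in> A \<Longrightarrow> b \<in> A \<Longrightarrow> a + b \<in> A"
    and deg_add: "\<And>a b. d (a + b) = d a + d b"
    and deg_eq_0: "\<And>a. a \<in> A \<Longrightarrow> d a = 0 \<Longrightarrow> a = 0"
begin

lemma monoid_hull_atoms: "monoid_hull (atoms A) = A"
proof
  show "monoid_hull (atoms A) \<subseteq> A"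
    by (rule monoid_hull_least) (auto simp: atoms_def zero_mem add_mem)
  have "a \<in> monoid_hull (atoms A)" if "a \<in> A" for a
    using that
  proof (induction "d a" arbitrary: a rule: less_induct)
    case less
    consider "a = 0" | "a \<in> atoms A" | b c where "b \<in> A" "c \<in> A" "a = b + c" "b \<noteq> 0" "c \<noteq> 0"
      using less.prems by (auto simp: atoms_def)
    then show ?case
    proof cases
      case 3
      then have "d b < d a" "d c < d a"
        using deg_eq_0 by (auto simp: deg_add)
      then show ?thesis
        using less.hyps 3 by (simp add: monoid_hull_add)
    qed (auto intro: monoid_hull.zero monoid_hull_incl)
  qed
  then show "A \<subseteq> monoid_hull (atoms A)" by blast
qed

lemma monoid_hull_eq_iff: "monoid_hull B = A \<longleftrightarrow> atoms A \<subseteq> B \<and> B \<subseteq> A"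
proof
  assume "monoid_hull B = A"
  then show "atoms A \<subseteq> B \<and> B \<subseteq> A"
    using atom_in_monoid_hull[of _ B A] monoid_hull_incl[of _ B] by (auto simp: atoms_def)
next
  assume "atoms A \<subseteq> B \<and> B \<subseteq> A"
  then show "monoid_hull B = A"
    using monoid_hull_mono[of "atoms A" B] monoid_hull_atoms monoid_hull_least[of B A] zero_mem add_mem
    by blast
qed

text \<open>
  Whatever generating set \<open>C\<close> one starts from, discarding the elements generated by the
  others leaves the same set: removing an atom destroys generation, and removing anything else
  keeps all atoms.
\<close>

lemma irredundant_eq_atoms:
  assumes "monoid_hull C = A"
  shows "{a \<in> C. a \<notin> monoid_hull (C - {a})} = atoms A"
proof -
  have C: "atoms A \<subseteq> C" "C \<subseteq> A"
    using assms by (auto simp: monoid_hull_eq_iff)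
  have "a \<notin> monoid_hull (C - {a}) \<longleftrightarrow> a \<in> atoms A" if "a \<in> C" for a
  proof
    assume a: "a \<notin> monoid_hull (C - {a})"
    show "a \<in> atoms A"
    proof (rule ccontr)
      assume "a \<notin> atoms A"
      then have "monoid_hull (C - {a}) = A"
        using C unfolding monoid_hull_eq_iff by blast
      with a that C show False by blast
    qed
  next
    assume a: "a \<in> atoms A"
    have "monoid_hull (C - {a}) \<subseteq> A"
      using monoid_hull_mono[of "C - {a}" C] assms by auto
    then show "a \<notin> monoid_hull (C - {a})"
      using atom_in_monoid_hull[OF _ a] by blast
  qed
  then show ?thesis using C by auto
qed

end

lemma irredundant_monomials:
  fixes A :: "exponent set"
  assumes "graded_submonoid A d" "monoid_hull C = A"
  shows "{m \<in> mono_of ` C. m \<notin> alg_span (mono_of ` C - {m})} = mono_of ` atoms A"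
proof -
  have "mono_of ` C - {mono_of a} = mono_of ` (C - {a})" for a
    using inj_mono_of by (auto dest: injD)
  moreover have "mono_of a \<in> alg_span (mono_of ` B) \<longleftrightarrow> a \<in> monoid_hull B" for a B
    by (simp add: alg_span_monomials) (simp add: mono_of_def)
  ultimately show ?thesis
    using graded_submonoid.irredundant_eq_atoms[OF assms] by (auto simp: image_iff)
qed

text \<open>
  Minimality with respect to inclusion and irredundancy single out the same monomials, because
  every monomial generating set contains those whose exponents are atoms.
\<close>

lemma minimal_monomial_generators_iff:
  fixes A :: "exponent set"
  assumes A: "graded_submonoid A d" and inv: "invariant_ring G n \<phi> = {f. Poly_Mapping.keys f \<subseteq> A}"
  shows "minimal_monomial_generators G n \<phi> M \<longleftrightarrow> M = mono_of ` atoms A"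
proof -
  note hull = alg_span_monomials_eq_iff graded_submonoid.monoid_hull_eq_iff[OF A]
  have "atoms A \<subseteq> A"
    by (auto simp: atoms_def)
  then have span_atoms: "alg_span (mono_of ` atoms A) = invariant_ring G n \<phi>"
    unfolding inv hull by blast
  show ?thesis
  proof
    assume M: "minimal_monomial_generators G n \<phi> M"
    then obtain B where B: "M = mono_of ` B"
      by (metis minimal_monomial_generators_def subset_imageE)
    have AB: "atoms A \<subseteq> B"
      using M unfolding minimal_monomial_generators_def inv B hull by blast
    have "\<not> mono_of ` atoms A \<subset> M"
      using M span_atoms unfolding minimal_monomial_generators_def by blast
    then show "M = mono_of ` atoms A"
      using AB B by blast
  next
    assume M: "M = mono_of ` atoms A"
    have "alg_span N \<noteq> invariant_ring G n \<phi>" if N: "N \<subset> M" for N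
    proof
      assume eq: "alg_span N = invariant_ring G n \<phi>"
      obtain B where "N = mono_of ` B"
        using N M by (metis psubset_imp_subset subset_imageE)
      with eq have "alg_span (mono_of ` B) = invariant_ring G n \<phi>" by simp
      then have "atoms A \<subseteq> B" unfolding inv hull by blast
      with \<open>N = mono_of ` B\<close> N M show False by blast
    qed
    moreover have "alg_span M = invariant_ring G n \<phi>"
      using span_atoms M by simp
    ultimately show "minimal_monomial_generators G n \<phi> M"
      using M by (auto simp: minimal_monomial_generators_def)
  qed
qed

section \<open>Exponent vectors in the kernel of the weight matrix\<close>

definition kernel_exponents :: "nat \<Rightarrow> nat \<Rightarrow> nat \<Rightarrow> (nat \<Rightarrow> nat \<Rightarrow> nat) \<Rightarrow> exponent set" where
  "kernel_exponents p k n W =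
     {\<alpha>. Poly_Mapping.keys \<alpha> \<subseteq> {..<n} \<and> in_kernel_mod p k n W (\<lambda>j. int (Poly_Mapping.lookup \<alpha> j))}"

lemma in_kernel_mod_iff_pairing:
  "in_kernel_mod p k n W x \<longleftrightarrow> (\<forall>i<k. [pairing n (\<lambda>j. int (W i j)) x = 0] (mod int p))"
  by (simp add: in_kernel_mod_def pairing_def)

lemma in_kernel_mod_cong:
  assumes "\<And>j. j < n \<Longrightarrow> [x j = y j] (mod int p)"
  shows "in_kernel_mod p k n W x \<longleftrightarrow> in_kernel_mod p k n W y"
  unfolding in_kernel_mod_iff_pairing
  using pairing_cong_right[of n x y, OF assms] by (blast intro: cong_trans cong_sym)

lemma in_kernel_mod_add:
  assumes "in_kernel_mod p k n W x"
  shows "in_kernel_mod p k n W (\<lambda>j. x j + y j) \<longleftrightarrow> in_kernel_mod p k n W y"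
proof -
  have "[pairing n w x + pairing n w y = 0] (mod int p) \<longleftrightarrow> [pairing n w y = 0] (mod int p)"
    if "[pairing n w x = 0] (mod int p)" for w
    using that by (simp add: cong_0_iff dvd_add_right_iff)
  then show ?thesis
    using assms by (auto simp: in_kernel_mod_iff_pairing pairing_add_right)
qed

text \<open>
  This gives an induction principle for exponent vectors that adds one variable at a time.
\<close>

lemma exponent_in_monoid_hull:
  assumes "\<And>j. j \<in> Poly_Mapping.keys \<alpha> \<Longrightarrow> Poly_Mapping.single j 1 \<in> B"
  shows "\<alpha> \<in> monoid_hull (B :: exponent set)"
proof -
  have single: "Poly_Mapping.single j m \<in> monoid_hull B" if "Poly_Mapping.single j 1 \<in> B" for j m
  proof (induction m)
    case 0
    show ?case by (simp add: monoid_hull.zero)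
  next
    case (Suc m)
    have "Poly_Mapping.single j (Suc m) = Poly_Mapping.single j 1 + Poly_Mapping.single j m"
      by (simp add: single_add[symmetric])
    then show ?case using Suc that by (simp add: monoid_hull.add)
  qed
  have "(\<Sum>j\<in>J. Poly_Mapping.single j (Poly_Mapping.lookup \<alpha> j)) \<in> monoid_hull B"
    if "finite J" "J \<subseteq> Poly_Mapping.keys \<alpha>" for J
    using that
    by (induction J rule: finite_induct) (auto intro: monoid_hull.zero monoid_hull_add single assms)
  from this[of "Poly_Mapping.keys \<alpha>"] show ?thesis
    by (simp add: sum_monomials)
qed

lemma graded_submonoid_kernel_exponents:
  "graded_submonoid (kernel_exponents p k n W) (\<lambda>\<alpha>. \<Sum>j<n. Poly_Mapping.lookup \<alpha> j)"
proof
  show "0 \<in> kernel_exponents p k n W"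
    by (simp add: kernel_exponents_def in_kernel_mod_def)
next
  fix \<alpha> \<beta>
  assume "\<alpha> \<in> kernel_exponents p k n W" "\<beta> \<in> kernel_exponents p k n W"
  then show "\<alpha> + \<beta> \<in> kernel_exponents p k n W"
    using Poly_Mapping.keys_add[of \<alpha> \<beta>]
    by (auto simp: kernel_exponents_def lookup_add in_kernel_mod_add)
next
  fix \<alpha> \<beta> :: exponent
  show "(\<Sum>j<n. Poly_Mapping.lookup (\<alpha> + \<beta>) j)
      = (\<Sum>j<n. Poly_Mapping.lookup \<alpha> j) + (\<Sum>j<n. Poly_Mapping.lookup \<beta> j)"
    by (simp add: lookup_add sum.distrib)
next
  fix \<alpha>
  assume "\<alpha> \<in> kernel_exponents p k n W" "(\<Sum>j<n. Poly_Mapping.lookup \<alpha> j) = 0"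
  then have "Poly_Mapping.keys \<alpha> \<subseteq> {..<n}" and "\<forall>j<n. j \<notin> Poly_Mapping.keys \<alpha>"
    by (simp_all add: kernel_exponents_def in_keys_iff)
  then have "Poly_Mapping.keys \<alpha> = {}" by blast
  then show "\<alpha> = 0" by simp
qed

text \<open>
  These are the exponents of the monomials grown from any collection of seeds, described without
  mentioning the seeds: all kernel vectors reduced modulo \<open>p\<close>, and the pure powers.
\<close>

definition grown_exponents :: "nat \<Rightarrow> nat \<Rightarrow> nat \<Rightarrow> (nat \<Rightarrow> nat \<Rightarrow> nat) \<Rightarrow> exponent set" where
  "grown_exponents p k n W =
     {\<alpha> \<in> kernel_exponents p k n W. \<forall>j<n. Poly_Mapping.lookup \<alpha> j < p} \<union>
     (\<lambda>j. Poly_Mapping.single j p) ` {..<n}"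

lemma pure_power_in_kernel_exponents:
  "j < n \<Longrightarrow> Poly_Mapping.single j p \<in> kernel_exponents p k n W"
  using in_kernel_mod_cong[of n "\<lambda>l. int (Poly_Mapping.lookup (Poly_Mapping.single j p) l)" "\<lambda>_. 0" p k W]
  by (auto simp: kernel_exponents_def lookup_single when_def in_kernel_mod_def cong_0_iff split: if_splits)

text \<open>
  A kernel exponent with an entry of at least \<open>p\<close> stays in the kernel when \<open>p\<close> is subtracted from
  that entry, which splits off a pure power and lowers the degree.
\<close>

lemma monoid_hull_grown_exponents:
  assumes "p > 0"
  shows "monoid_hull (grown_exponents p k n W) = kernel_exponents p k n W"
proof
  interpret graded_submonoid "kernel_exponents p k n W" "\<lambda>\<alpha>. \<Sum>j<n. Poly_Mapping.lookup \<alpha> j"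
    by (rule graded_submonoid_kernel_exponents)
  show "monoid_hull (grown_exponents p k n W) \<subseteq> kernel_exponents p k n W"
    by (rule monoid_hull_least)
      (auto simp: grown_exponents_def pure_power_in_kernel_exponents zero_mem add_mem)
  have "\<alpha> \<in> monoid_hull (grown_exponents p k n W)" if "\<alpha> \<in> kernel_exponents p k n W" for \<alpha>
    using that
  proof (induction "\<Sum>j<n. Poly_Mapping.lookup \<alpha> j" arbitrary: \<alpha> rule: less_induct)
    case less
    show ?case
    proof (cases "\<forall>j<n. Poly_Mapping.lookup \<alpha> j < p")
      case True
      then show ?thesis
        using less.prems by (auto simp: grown_exponents_def intro: monoid_hull_incl)
    next
      case False
      then obtain j where j: "j < n" "p \<le> Poly_Mapping.lookup \<alpha> j"
        by (auto simp: not_less)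
      define \<beta> where "\<beta> = \<alpha> - Poly_Mapping.single j p"
      have \<alpha>: "\<alpha> = Poly_Mapping.single j p + \<beta>"
        by (rule poly_mapping_eqI) (use j in \<open>auto simp: \<beta>_def lookup_add lookup_minus lookup_single when_def\<close>)
      have keys: "Poly_Mapping.keys \<beta> \<subseteq> {..<n}"
      proof -
        have "Poly_Mapping.keys \<beta> \<subseteq> Poly_Mapping.keys \<alpha>"
          by (auto simp: \<alpha> in_keys_iff lookup_add)
        then show ?thesis using less.prems by (auto simp: kernel_exponents_def)
      qed
      have "in_kernel_mod p k n W (\<lambda>l. int (Poly_Mapping.lookup (Poly_Mapping.single j p) l))"
        using pure_power_in_kernel_exponents[OF j(1), of p k W] by (simp add: kernel_exponents_def)
      then have \<beta>: "\<beta> \<in> kernel_exponents p k n W"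
        using less.prems keys by (simp add: kernel_exponents_def \<alpha> lookup_add in_kernel_mod_add)
      have "(\<Sum>l<n. Poly_Mapping.lookup (Poly_Mapping.single j p) l) = p"
        using j(1) by (simp add: lookup_single when_def)
      then have "(\<Sum>l<n. Poly_Mapping.lookup \<beta> l) < (\<Sum>l<n. Poly_Mapping.lookup \<alpha> l)"
        using assms by (simp add: \<alpha> deg_add)
      then show ?thesis
        using less.hyps \<beta> j(1) by (auto simp: \<alpha> grown_exponents_def intro: monoid_hull.add)
    qed
  qed
  then show "kernel_exponents p k n W \<subseteq> monoid_hull (grown_exponents p k n W)" by blast
qed

lemma pvar_power: "pvar j ^ m = mono_of (Poly_Mapping.single j m)"
  by (induction m) (simp_all add: pvar_def mono_of_def mult_single single_add[symmetric])

text \<open>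
  Since the seeds generate the kernel modulo \<open>p\<close>, their reduced combinations are exactly the
  kernel vectors with entries below \<open>p\<close>, independently of the choice of seeds.
\<close>

lemma grown_monomials_eq:
  assumes S: "generates_kernel_mod p k n W S" and p: "p > 0"
  shows "grown_monomials p n S = mono_of ` grown_exponents p k n W"
proof -
  have ker: "in_kernel_mod p k n W x \<longleftrightarrow> (\<exists>c. \<forall>j<n. [x j = int_combination S c j] (mod int p))" for x
    using S unfolding generates_kernel_mod_def by (rule spec)
  have "(\<exists>c. \<forall>j<n. int (Poly_Mapping.lookup \<alpha> j) = int_combination S c j mod int p) \<longleftrightarrow>
        in_kernel_mod p k n W (\<lambda>j. int (Poly_Mapping.lookup \<alpha> j)) \<and> (\<forall>j<n. Poly_Mapping.lookup \<alpha> j < p)"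
    (is "?L \<longleftrightarrow> ?R") for \<alpha>
  proof
    assume ?L
    then obtain c where c: "\<forall>j<n. int (Poly_Mapping.lookup \<alpha> j) = int_combination S c j mod int p" ..
    have small: "Poly_Mapping.lookup \<alpha> j < p" if "j < n" for j
    proof -
      have "int (Poly_Mapping.lookup \<alpha> j) < int p"
        using c that p by simp
      then show ?thesis by simp
    qed
    have "\<forall>j<n. [int (Poly_Mapping.lookup \<alpha> j) = int_combination S c j] (mod int p)"
      using c by (simp add: cong_def)
    then have "in_kernel_mod p k n W (\<lambda>j. int (Poly_Mapping.lookup \<alpha> j))"
      unfolding ker by (rule exI[of _ c])
    with small show ?R by simp
  next
    assume R: ?R
    then have "\<exists>c. \<forall>j<n. [int (Poly_Mapping.lookup \<alpha> j) = int_combination S c j] (mod int p)"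
      unfolding ker by (rule conjunct1)
    then show ?L using R by (simp add: cong_def)
  qed
  then have "reduced_combinations p n S =
      mono_of ` {\<alpha> \<in> kernel_exponents p k n W. \<forall>j<n. Poly_Mapping.lookup \<alpha> j < p}"
    unfolding reduced_combinations_def kernel_exponents_def by auto
  moreover have "{pvar j ^ p | j. j < n} = mono_of ` (\<lambda>j. Poly_Mapping.single j p) ` {..<n}"
    by (auto simp: pvar_power)
  ultimately show ?thesis
    by (simp add: grown_monomials_def grown_exponents_def image_Un)
qed

lemma constructed_from_seeds_eq_atoms:
  assumes "generates_kernel_mod p k n W S" "p > 0"
  shows "constructed_from_seeds p n S = mono_of ` atoms (kernel_exponents p k n W)"
  unfolding constructed_from_seeds_def grown_monomials_eq[OF assms]
  by (rule irredundant_monomials[OF graded_submonoid_kernel_exponents monoid_hull_grown_exponents[OF assms(2)]])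

text \<open>
  The generators of the kernel are lifted to nonnegative integer vectors. Only their residues
  matter, so the lift has room to make the resulting exponents pairwise distinct, which is what
  gives a set of exactly \<open>n - k\<close> elements.
\<close>

lemma exists_exponents_generating_kernel_mod:
  assumes p: "prime p" and "0 < n"
    and ind: "independent_rows_mod p k n (\<lambda>i j. int (W i j))"
  shows "\<exists>S. finite S \<and> card S = n - k \<and> S \<subseteq> kernel_exponents p k n W \<and> generates_kernel_mod p k n W S"
proof (rule kernel_mod_generators[OF p ind, folded in_kernel_mod_iff_pairing])
  fix L :: "nat set" and v
  assume L: "finite L" "card L = n - k"
    and gen: "\<And>x. in_kernel_mod p k n W x \<longleftrightarrow> (\<exists>c. \<forall>j<n. [x j = (\<Sum>l\<in>L. c l * v l j)] (mod int p))"
  have p0: "p > 0" using p prime_gt_0_nat by blast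
  \<comment> \<open>the shift by \<open>l * p\<close> lets the first entry recover the index \<open>l\<close>\<close>
  define \<beta> :: "nat \<Rightarrow> exponent" where
    "\<beta> l = (\<Sum>j<n. Poly_Mapping.single j (nat (v l j mod int p) + l * p))" for l
  have lookup_\<beta>: "Poly_Mapping.lookup (\<beta> l) j = (if j < n then nat (v l j mod int p) + l * p else 0)" for l j
    by (simp add: \<beta>_def lookup_sum lookup_single when_def)
  have \<beta>_cong: "[int (Poly_Mapping.lookup (\<beta> l) j) = v l j] (mod int p)" if "j < n" for l j
    using that p0 by (simp add: lookup_\<beta> cong_def)
  have inj: "inj_on \<beta> L"
  proof (rule inj_onI)
    have "l = Poly_Mapping.lookup (\<beta> l) 0 div p" for l
    proof -
      have "nat (v l 0 mod int p) < p"
        using p0 by (simp add: nat_less_iff)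
      then show ?thesis using \<open>0 < n\<close> by (simp add: lookup_\<beta>)
    qed
    then show "l = l'" if "\<beta> l = \<beta> l'" for l l'
      using that by metis
  qed
  have comb: "[int_combination (\<beta> ` L) c j = (\<Sum>l\<in>L. c (\<beta> l) * v l j)] (mod int p)" if "j < n" for c j
    unfolding int_combination_def sum.reindex[OF inj] o_def
    by (intro cong_sum cong_mult cong_refl \<beta>_cong that)
  have "generates_kernel_mod p k n W (\<beta> ` L)"
    unfolding generates_kernel_mod_def gen
  proof (intro allI iffI)
    fix x assume "\<exists>c. \<forall>j<n. [x j = (\<Sum>l\<in>L. c l * v l j)] (mod int p)"
    then obtain c where c: "\<forall>j<n. [x j = (\<Sum>l\<in>L. c l * v l j)] (mod int p)" ..
    have "[x j = int_combination (\<beta> ` L) (\<lambda>b. c (inv_into L \<beta> b)) j] (mod int p)" if "j < n" for j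
    proof -
      have "(\<Sum>l\<in>L. c (inv_into L \<beta> (\<beta> l)) * v l j) = (\<Sum>l\<in>L. c l * v l j)"
        by (intro sum.cong) (simp_all add: inv_into_f_f[OF inj])
      then show ?thesis
        using cong_trans[OF c[rule_format, OF that]] cong_sym[OF comb[OF that, of "\<lambda>b. c (inv_into L \<beta> b)"]]
        by simp
    qed
    then show "\<exists>c. \<forall>j<n. [x j = int_combination (\<beta> ` L) c j] (mod int p)" by blast
  next
    fix x assume "\<exists>c. \<forall>j<n. [x j = int_combination (\<beta> ` L) c j] (mod int p)"
    then obtain c where c: "\<forall>j<n. [x j = int_combination (\<beta> ` L) c j] (mod int p)" ..
    show "\<exists>c. \<forall>j<n. [x j = (\<Sum>l\<in>L. c l * v l j)] (mod int p)"
    proof (intro exI[of _ "\<lambda>l. c (\<beta> l)"] allI impI)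
      fix j assume "j < n"
      then show "[x j = (\<Sum>l\<in>L. c (\<beta> l) * v l j)] (mod int p)"
        using cong_trans[OF c[rule_format] comb] by simp
    qed
  qed
  moreover have "\<beta> l \<in> kernel_exponents p k n W" if "l \<in> L" for l
  proof -
    have "(\<Sum>m\<in>L. (if m = l then 1 else 0) * v m j) = v l j" for j
      using L(1) that by (simp add: if_distrib[of "\<lambda>a. a * _"] cong: if_cong)
    then have "in_kernel_mod p k n W (v l)"
      unfolding gen by (intro exI[of _ "\<lambda>m. if m = l then 1 else 0"]) simp
    then have "in_kernel_mod p k n W (\<lambda>j. int (Poly_Mapping.lookup (\<beta> l) j))"
      using in_kernel_mod_cong[of n "\<lambda>j. int (Poly_Mapping.lookup (\<beta> l) j)", OF \<beta>_cong] by simp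
    moreover have "Poly_Mapping.keys (\<beta> l) \<subseteq> {..<n}"
      by (auto simp: in_keys_iff lookup_\<beta> split: if_splits)
    ultimately show ?thesis by (simp add: kernel_exponents_def)
  qed
  ultimately show ?thesis
    using L by (intro exI[of _ "\<beta> ` L"]) (auto simp: card_image[OF inj])
qed

section \<open>Diagonal actions of elementary abelian groups\<close>

lemma scalar_mult_pvar: "scalar c * pvar j = Poly_Mapping.single (Poly_Mapping.single j 1) c"
  by (simp add: pvar_def scalar_mult_mono_of)

lemma scalar_mult_pvar_eq_iff: "scalar c * pvar j = scalar d * pvar j \<longleftrightarrow> c = d"
  unfolding scalar_mult_pvar by (metis lookup_single_eq)

lemma scalar_mult_scalar: "scalar a * (scalar b * f) = scalar (a * b) * f"
  by (simp add: scalar_def mult.assoc[symmetric] mult_single)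

lemma scalar_in_poly_ring: "scalar c \<in> poly_ring n"
  by (simp add: poly_ring_def scalar_def)

lemma mono_of_in_poly_ring: "mono_of \<alpha> \<in> poly_ring n \<longleftrightarrow> Poly_Mapping.keys \<alpha> \<subseteq> {..<n}"
  by (simp add: poly_ring_def mono_of_def)

lemma pvar_in_poly_ring: "j < n \<Longrightarrow> pvar j \<in> poly_ring n"
  by (simp add: pvar_def mono_of_in_poly_ring)

lemma add_in_poly_ring: "f \<in> poly_ring n \<Longrightarrow> g \<in> poly_ring n \<Longrightarrow> f + g \<in> poly_ring n"
  using Poly_Mapping.keys_add[of f g] by (auto simp: poly_ring_def)

lemma primitive_root_power_eq_1_iff:
  assumes "primitive_root_of_unity p \<mu>" "p > 0"
  shows "\<mu> ^ m = 1 \<longleftrightarrow> p dvd m"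
proof -
  have "\<mu> ^ m = \<mu> ^ (p * (m div p) + m mod p)" by simp
  also have "\<dots> = \<mu> ^ (m mod p)"
    using assms(1) by (simp only: power_add power_mult primitive_root_of_unity_def) simp
  finally have "\<mu> ^ m = 1 \<longleftrightarrow> \<mu> ^ (m mod p) = 1" by simp
  also have "\<dots> \<longleftrightarrow> m mod p = 0"
    using assms mod_less_divisor[of p m] by (auto simp: primitive_root_of_unity_def)
  finally show ?thesis by (simp add: dvd_eq_mod_eq_0)
qed

lemma primitive_root_powers_inj:
  assumes "primitive_root_of_unity p \<mu>" "p > 0"
  shows "inj_on (\<lambda>a. \<mu> ^ a) {..<p}"
proof (rule linorder_inj_onI')
  fix a b assume ab: "a \<in> {..<p}" "b \<in> {..<p}" "a < b"
  have "\<mu> \<noteq> 0"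
    using assms by (auto simp: primitive_root_of_unity_def power_0_left)
  show "\<mu> ^ a \<noteq> \<mu> ^ b"
  proof
    assume "\<mu> ^ a = \<mu> ^ b"
    also have "\<mu> ^ b = \<mu> ^ a * \<mu> ^ (b - a)"
      using ab by (simp add: power_add[symmetric])
    finally have "\<mu> ^ (b - a) = 1"
      using \<open>\<mu> \<noteq> 0\<close> by simp
    with assms(1) ab show False
      unfolding primitive_root_of_unity_def by (metis diff_is_0_eq lessThan_iff less_imp_diff_less not_le zero_less_diff)
  qed
qed

lemma root_of_unity_is_primitive_root_power:
  assumes "primitive_root_of_unity p \<mu>" "p > 0" "c ^ p = 1"
  shows "\<exists>a<p. c = \<mu> ^ a"
proof -
  have sub: "(\<lambda>a. \<mu> ^ a) ` {..<p} \<subseteq> {z. z ^ p = 1}"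
    using assms(1) by (auto simp: primitive_root_of_unity_def power_commutes
        power_mult[symmetric] mult.commute[of _ p]) (simp add: power_mult)
  have "card ((\<lambda>a. \<mu> ^ a) ` {..<p}) = p"
    using primitive_root_powers_inj[OF assms(1,2)] by (simp add: card_image)
  moreover have "card {z::complex. z ^ p = 1} = p"
    using assms(2) by (rule card_roots_unity_eq)
  ultimately have "(\<lambda>a. \<mu> ^ a) ` {..<p} = {z. z ^ p = 1}"
    using sub assms(2) by (intro card_subset_eq finite_roots_unity) auto
  then show ?thesis using assms(3) by blast
qed

text \<open>
  The map \<open>h\<close> provides coordinates on the group: elements are handled as residue vectors \<open>v\<close>
  acting through \<open>h v\<close>, so that they can be paired with the rows of the weight matrix.
\<close>

locale elementary_diagonal_action =
  fixes G :: "('g, 'b) monoid_scheme"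
    and \<phi> :: "'g \<Rightarrow> cpoly \<Rightarrow> cpoly"
    and h :: "(nat \<Rightarrow> int) \<Rightarrow> 'g"
    and \<mu> :: complex
    and p k n :: nat
  assumes prime: "prime p"
    and group: "group G"
    and iso: "h \<in> iso (elementary_group p k) G"
    and root: "primitive_root_of_unity p \<mu>"
    and action: "algebra_action G n \<phi>"
    and diagonal: "linear_diagonal G n \<phi>"
begin

abbreviation E where "E \<equiv> elementary_group p k"

abbreviation W where "W \<equiv> weight_matrix p k \<mu> h \<phi>"

lemma p_pos: "p > 0" and p_gt_1: "p > 1"
  using prime prime_gt_0_nat prime_gt_1_nat by auto

lemma group_E: "group E"
  by simp

lemma carrier_E: "v \<in> carrier E \<longleftrightarrow> v \<in> extensional {..<k} \<and> (\<forall>i<k. 0 \<le> v i \<and> v i < int p)"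
  using p_pos by (auto simp: PiE_iff carrier_integer_mod_group)

lemma mult_E: "v \<otimes>\<^bsub>E\<^esub> w = (\<lambda>i\<in>{..<k}. (v i + w i) mod int p)"
  by simp

lemma one_E: "\<one>\<^bsub>E\<^esub> = (\<lambda>i\<in>{..<k}. 0)"
  by simp

lemma unit_vector_in_E: "unit_vector k i \<in> carrier E"
  using p_gt_1 by (simp add: carrier_E unit_vector_def)

lemma h_in_G: "v \<in> carrier E \<Longrightarrow> h v \<in> carrier G"
  using iso by (auto simp: iso_def hom_def)

lemma h_mult: "v \<in> carrier E \<Longrightarrow> w \<in> carrier E \<Longrightarrow> h (v \<otimes>\<^bsub>E\<^esub> w) = h v \<otimes>\<^bsub>G\<^esub> h w"
  using iso unfolding iso_def hom_def by blast

lemma carrier_G: "carrier G = h ` carrier E"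
  using iso by (simp only: iso_def bij_betw_def mem_Collect_eq)

lemma h_one: "h \<one>\<^bsub>E\<^esub> = \<one>\<^bsub>G\<^esub>"
  by (rule hom_one[OF _ group_E group]) (use iso in \<open>simp only: iso_def mem_Collect_eq\<close>)

interpretation act: group_action G "poly_ring n" \<phi>
  using action by (simp add: algebra_action_def)

lemma act_one: "f \<in> poly_ring n \<Longrightarrow> \<phi> (h \<one>\<^bsub>E\<^esub>) f = f"
  unfolding h_one using act.id_eq_one by (metis restrict_apply')

lemma act_mult:
  assumes "v \<in> carrier E" "w \<in> carrier E" "f \<in> poly_ring n"
  shows "\<phi> (h (v \<otimes>\<^bsub>E\<^esub> w)) f = \<phi> (h v) (\<phi> (h w) f)"
  unfolding h_mult[OF assms(1,2)] by (rule act.composition_rule[OF assms(3) h_in_G h_in_G]) fact+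

lemma act_scalar: "v \<in> carrier E \<Longrightarrow> \<phi> (h v) (scalar c) = scalar c"
  and act_add: "v \<in> carrier E \<Longrightarrow> a \<in> poly_ring n \<Longrightarrow> b \<in> poly_ring n \<Longrightarrow>
    \<phi> (h v) (a + b) = \<phi> (h v) a + \<phi> (h v) b"
  and act_times: "v \<in> carrier E \<Longrightarrow> a \<in> poly_ring n \<Longrightarrow> b \<in> poly_ring n \<Longrightarrow>
    \<phi> (h v) (a * b) = \<phi> (h v) a * \<phi> (h v) b"
  using action h_in_G unfolding algebra_action_def by blast+

lemma act_scalar_mult:
  assumes "v \<in> carrier E" "f \<in> poly_ring n"
  shows "\<phi> (h v) (scalar c * f) = scalar c * \<phi> (h v) f"
  using act_times[OF assms(1) scalar_in_poly_ring assms(2)] act_scalar[OF assms(1)] by metis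

text \<open>
  The vector acting here is the \<open>m\<close>-th multiple of a standard generator. Taking \<open>m = p\<close> gives the
  identity, which forces the scalar \<open>c\<close> to be a \<open>p\<close>-th root of unity.
\<close>

lemma act_generator_power:
  assumes "i < k" "j < n" "\<phi> (h (unit_vector k i)) (pvar j) = scalar c * pvar j"
  shows "\<phi> (h (\<lambda>l\<in>{..<k}. if l = i then int m mod int p else 0)) (pvar j) = scalar (c ^ m) * pvar j"
proof (induction m)
  case 0
  have "(\<lambda>l\<in>{..<k}. if l = i then int 0 mod int p else 0) = \<one>\<^bsub>E\<^esub>"
    by (auto simp: one_E)
  moreover have "scalar 1 = 1" by (simp add: scalar_def)
  ultimately show ?case
    using act_one[OF pvar_in_poly_ring[OF assms(2)]] by (metis mult_1 power_0)
next
  case (Suc m)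
  define v where "v = (\<lambda>l\<in>{..<k}. if l = i then int m mod int p else 0)"
  have v: "v \<in> carrier E"
    unfolding carrier_E using p_pos by (simp add: v_def)
  have eq: "(\<lambda>l\<in>{..<k}. if l = i then int (Suc m) mod int p else 0) = unit_vector k i \<otimes>\<^bsub>E\<^esub> v"
    unfolding mult_E by (rule restrict_ext) (simp add: v_def unit_vector_def mod_add_right_eq)
  have "\<phi> (h (unit_vector k i \<otimes>\<^bsub>E\<^esub> v)) (pvar j) = \<phi> (h (unit_vector k i)) (scalar (c ^ m) * pvar j)"
    using act_mult[OF unit_vector_in_E v pvar_in_poly_ring[OF assms(2)]] Suc.IH by (metis v_def)
  also have "\<dots> = scalar (c ^ m) * (scalar c * pvar j)"
    using act_scalar_mult[OF unit_vector_in_E pvar_in_poly_ring[OF assms(2)]] assms(3) by metis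
  also have "\<dots> = scalar (c ^ Suc m) * pvar j"
    unfolding scalar_mult_scalar by (simp add: mult.commute)
  finally show ?case unfolding eq .
qed

lemma act_generator:
  assumes "i < k" "j < n"
  shows "\<phi> (h (unit_vector k i)) (pvar j) = scalar (\<mu> ^ W i j) * pvar j"
proof -
  obtain c where c: "\<phi> (h (unit_vector k i)) (pvar j) = scalar c * pvar j"
    using diagonal h_in_G[OF unit_vector_in_E] assms(2) unfolding linear_diagonal_def by blast
  have "(\<lambda>l\<in>{..<k}. if l = i then int p mod int p else 0) = \<one>\<^bsub>E\<^esub>"
    by (auto simp: one_E)
  then have "scalar (c ^ p) * pvar j = pvar j"
    using act_generator_power[OF assms c, of p] act_one[OF pvar_in_poly_ring[OF assms(2)]] by metis
  also have "pvar j = scalar 1 * pvar j"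
    by (simp add: scalar_def)
  finally have "c ^ p = 1"
    by (simp only: scalar_mult_pvar_eq_iff)
  then obtain a where a: "a < p" "c = \<mu> ^ a"
    using root_of_unity_is_primitive_root_power[OF root p_pos] by blast
  have "W i j = a"
    unfolding weight_matrix_def
  proof (rule the_equality)
    show "a < p \<and> \<phi> (h (unit_vector k i)) (pvar j) = scalar (\<mu> ^ a) * pvar j"
      using a c by simp
    fix b assume b: "b < p \<and> \<phi> (h (unit_vector k i)) (pvar j) = scalar (\<mu> ^ b) * pvar j"
    then have "\<mu> ^ b = \<mu> ^ a"
      using a c scalar_mult_pvar_eq_iff by metis
    then show "b = a"
      using primitive_root_powers_inj[OF root p_pos] a(1) b by (auto dest: inj_onD)
  qed
  then show ?thesis using a c by simp
qed

text \<open>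
  Every group element is a product of standard generators, found by lowering one positive
  coordinate of \<open>v\<close> at a time.
\<close>

lemma act_pvar:
  assumes "v \<in> carrier E" "j < n"
  shows "\<phi> (h v) (pvar j) = scalar (\<mu> ^ (\<Sum>i<k. nat (v i) * W i j)) * pvar j"
  using assms(1)
proof (induction "\<Sum>i<k. nat (v i)" arbitrary: v rule: less_induct)
  case less
  have v: "v \<in> extensional {..<k}" "\<forall>i<k. 0 \<le> v i \<and> v i < int p"
    using less.prems unfolding carrier_E by auto
  show ?case
  proof (cases "\<forall>i<k. v i = 0")
    case True
    then have "v = \<one>\<^bsub>E\<^esub>"
      unfolding one_E using v(1) by (auto simp: extensional_def)
    moreover have "(\<Sum>i<k. nat (v i) * W i j) = 0"
      using True by simp
    moreover have "scalar 1 = 1" by (simp add: scalar_def)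
    ultimately show ?thesis
      using act_one[OF pvar_in_poly_ring[OF assms(2)]] by (metis mult_1 power_0)
  next
    case False
    then obtain i where i: "i < k" "v i > 0"
      using v(2) by (metis order_le_less)
    define w where "w = v(i := v i - 1)"
    have w: "w \<in> carrier E"
      unfolding carrier_E using v i by (auto simp: w_def extensional_def)
    have eq: "v = w \<otimes>\<^bsub>E\<^esub> unit_vector k i"
    proof
      fix l
      show "v l = (w \<otimes>\<^bsub>E\<^esub> unit_vector k i) l"
        unfolding mult_E using v by (auto simp: w_def unit_vector_def extensional_def)
    qed
    have nat_v: "nat (v l) = nat (w l) + (if l = i then 1 else 0)" for l
    proof (cases "l = i")
      case True
      have "nat (v i) = nat (v i - 1) + 1" using i(2) by linarith
      then show ?thesis using True by (simp add: w_def)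
    qed (simp add: w_def)
    have "(\<Sum>l<k. nat (w l)) < (\<Sum>l<k. nat (v l))"
      unfolding nat_v using i(1) by (simp add: sum.distrib)
    then have IH: "\<phi> (h w) (pvar j) = scalar (\<mu> ^ (\<Sum>i<k. nat (w i) * W i j)) * pvar j"
      using less.hyps w by blast
    have "(\<Sum>l<k. nat (v l) * W l j) = (\<Sum>l<k. nat (w l) * W l j + (if l = i then W i j else 0))"
      unfolding nat_v by (intro sum.cong) auto
    then have sum_v: "(\<Sum>l<k. nat (v l) * W l j) = W i j + (\<Sum>l<k. nat (w l) * W l j)"
      using i(1) by (simp add: sum.distrib)
    have "\<phi> (h v) (pvar j) = \<phi> (h w) (scalar (\<mu> ^ W i j) * pvar j)"
      using act_mult[OF w unit_vector_in_E pvar_in_poly_ring[OF assms(2)]] act_generator[OF i(1) assms(2)]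
      unfolding eq by metis
    also have "\<dots> = scalar (\<mu> ^ W i j) * (scalar (\<mu> ^ (\<Sum>i<k. nat (w i) * W i j)) * pvar j)"
      using act_scalar_mult[OF w pvar_in_poly_ring[OF assms(2)]] IH by metis
    finally show ?thesis
      unfolding scalar_mult_scalar sum_v power_add .
  qed
qed

text \<open>
  The group element \<open>h v\<close> multiplies \<open>x\<^sup>\<alpha>\<close> by \<open>\<mu>\<close> to this power, a form that is bilinear in \<open>v\<close>
  and \<open>\<alpha>\<close>.
\<close>

definition weight :: "(nat \<Rightarrow> int) \<Rightarrow> exponent \<Rightarrow> nat" where
  "weight v \<alpha> = (\<Sum>j<n. (\<Sum>i<k. nat (v i) * W i j) * Poly_Mapping.lookup \<alpha> j)"

lemma weight_swap: "weight v \<alpha> = (\<Sum>i<k. nat (v i) * (\<Sum>j<n. W i j * Poly_Mapping.lookup \<alpha> j))"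
proof -
  have "weight v \<alpha> = (\<Sum>j<n. \<Sum>i<k. nat (v i) * (W i j * Poly_Mapping.lookup \<alpha> j))"
    by (simp add: weight_def sum_distrib_right mult.assoc)
  also have "\<dots> = (\<Sum>i<k. \<Sum>j<n. nat (v i) * (W i j * Poly_Mapping.lookup \<alpha> j))"
    by (rule sum.swap)
  finally show ?thesis by (simp add: sum_distrib_left)
qed

lemma weight_add: "weight v (\<alpha> + \<beta>) = weight v \<alpha> + weight v \<beta>"
  by (simp add: weight_def lookup_add distrib_left sum.distrib)

lemma weight_single: "j < n \<Longrightarrow> weight v (Poly_Mapping.single j 1) = (\<Sum>i<k. nat (v i) * W i j)"
  by (simp add: weight_def lookup_single when_def if_distrib cong: if_cong)

lemma act_monomial:
  assumes v: "v \<in> carrier E" and "Poly_Mapping.keys \<alpha> \<subseteq> {..<n}"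
  shows "\<phi> (h v) (mono_of \<alpha>) = scalar (\<mu> ^ weight v \<alpha>) * mono_of \<alpha>"
proof -
  have "\<alpha> \<in> monoid_hull ((\<lambda>j. Poly_Mapping.single j 1) ` {..<n})"
    using assms(2) by (intro exponent_in_monoid_hull) auto
  then have "Poly_Mapping.keys \<alpha> \<subseteq> {..<n} \<and> \<phi> (h v) (mono_of \<alpha>) = scalar (\<mu> ^ weight v \<alpha>) * mono_of \<alpha>"
  proof induction
    case zero
    have "mono_of 0 = scalar 1" by (simp add: mono_of_def scalar_def)
    moreover have "weight v 0 = 0" by (simp add: weight_def)
    moreover have "scalar 1 = 1" by (simp add: scalar_def)
    ultimately show ?case using act_scalar[OF v, of 1] by simp
  next
    case (add b x)
    then obtain j where j: "j < n" "b = Poly_Mapping.single j 1" by blast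
    have b: "mono_of b = pvar j" "weight v b = (\<Sum>i<k. nat (v i) * W i j)"
      using weight_single[OF j(1)] by (simp_all add: pvar_def j(2))
    have x: "mono_of x \<in> poly_ring n" using add.IH by (simp add: mono_of_in_poly_ring)
    have "\<phi> (h v) (mono_of (b + x)) = \<phi> (h v) (pvar j) * \<phi> (h v) (mono_of x)"
      unfolding mono_of_add b(1) by (rule act_times[OF v pvar_in_poly_ring[OF j(1)] x])
    also have "\<dots> = (scalar (\<mu> ^ weight v b) * mono_of b) * (scalar (\<mu> ^ weight v x) * mono_of x)"
      using act_pvar[OF v j(1)] add.IH by (simp only: b)
    also have "\<dots> = scalar (\<mu> ^ weight v (b + x)) * mono_of (b + x)"
      by (simp add: scalar_mult_mono_of mult_single weight_add power_add)
    finally show ?case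
      using add.IH j Poly_Mapping.keys_add[of b x] by auto
  qed
  then show ?thesis ..
qed

text \<open>
  Monomials are simultaneous eigenvectors, so the action merely rescales coefficients. Hence a
  polynomial is invariant if and only if each of its monomials is.
\<close>

lemma lookup_act:
  assumes v: "v \<in> carrier E" and f: "f \<in> poly_ring n"
  shows "Poly_Mapping.lookup (\<phi> (h v) f) \<alpha> = \<mu> ^ weight v \<alpha> * Poly_Mapping.lookup f \<alpha>"
proof -
  let ?s = "\<lambda>K. \<Sum>\<beta>\<in>K. Poly_Mapping.single \<beta> (Poly_Mapping.lookup f \<beta>)"
  have "?s K \<in> poly_ring n \<and>
      Poly_Mapping.lookup (\<phi> (h v) (?s K)) \<alpha> = \<mu> ^ weight v \<alpha> * Poly_Mapping.lookup (?s K) \<alpha>"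
    if "finite K" "K \<subseteq> Poly_Mapping.keys f" for K
    using that
  proof (induction K rule: finite_induct)
    case empty
    have "\<phi> (h v) (scalar 0) = scalar 0" by (rule act_scalar[OF v])
    then show ?case by (simp add: scalar_def poly_ring_def)
  next
    case (insert \<beta> K)
    let ?c = "Poly_Mapping.lookup f \<beta>"
    have \<beta>: "Poly_Mapping.keys \<beta> \<subseteq> {..<n}"
      using insert.prems f by (auto simp: poly_ring_def)
    have mem: "Poly_Mapping.single \<beta> ?c \<in> poly_ring n"
      using \<beta> by (simp add: poly_ring_def)
    have "\<phi> (h v) (Poly_Mapping.single \<beta> ?c) = scalar ?c * (scalar (\<mu> ^ weight v \<beta>) * mono_of \<beta>)"
      using act_scalar_mult[OF v, of "mono_of \<beta>" ?c] act_monomial[OF v \<beta>] \<beta>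
      by (simp only: scalar_mult_mono_of mono_of_in_poly_ring)
    also have "\<dots> = Poly_Mapping.single \<beta> (?c * \<mu> ^ weight v \<beta>)"
      unfolding scalar_mult_scalar by (rule scalar_mult_mono_of)
    finally have "Poly_Mapping.lookup (\<phi> (h v) (Poly_Mapping.single \<beta> ?c)) \<alpha> =
        \<mu> ^ weight v \<alpha> * Poly_Mapping.lookup (Poly_Mapping.single \<beta> ?c) \<alpha>"
      by (simp add: lookup_single when_def)
    then show ?case
      using insert act_add[OF v mem] by (simp add: add_in_poly_ring[OF mem] lookup_add distrib_left)
  qed
  from this[of "Poly_Mapping.keys f"] show ?thesis
    by (simp add: sum_monomials)
qed

lemma act_eq_self_iff:
  assumes v: "v \<in> carrier E" and f: "f \<in> poly_ring n"
  shows "\<phi> (h v) f = f \<longleftrightarrow> (\<forall>\<alpha>\<in>Poly_Mapping.keys f. p dvd weight v \<alpha>)"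
proof -
  have "\<phi> (h v) f = f \<longleftrightarrow> (\<forall>\<alpha>. \<mu> ^ weight v \<alpha> * Poly_Mapping.lookup f \<alpha> = Poly_Mapping.lookup f \<alpha>)"
    unfolding poly_mapping_eq_iff fun_eq_iff lookup_act[OF v f] ..
  also have "\<dots> \<longleftrightarrow> (\<forall>\<alpha>\<in>Poly_Mapping.keys f. \<mu> ^ weight v \<alpha> = 1)"
    by (auto simp: in_keys_iff)
  finally show ?thesis
    by (simp add: primitive_root_power_eq_1_iff[OF root p_pos])
qed

lemma kernel_exponents_iff_weight:
  assumes "Poly_Mapping.keys \<alpha> \<subseteq> {..<n}"
  shows "\<alpha> \<in> kernel_exponents p k n W \<longleftrightarrow> (\<forall>v\<in>carrier E. p dvd weight v \<alpha>)"
proof -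
  have iff: "\<alpha> \<in> kernel_exponents p k n W \<longleftrightarrow> (\<forall>i<k. p dvd (\<Sum>j<n. W i j * Poly_Mapping.lookup \<alpha> j))"
    using assms by (simp add: kernel_exponents_def in_kernel_mod_def cong_0_iff
        flip: of_nat_mult of_nat_sum)
  show ?thesis
  proof
    assume "\<alpha> \<in> kernel_exponents p k n W"
    then show "\<forall>v\<in>carrier E. p dvd weight v \<alpha>"
      unfolding iff weight_swap by (intro ballI dvd_sum) simp
  next
    assume *: "\<forall>v\<in>carrier E. p dvd weight v \<alpha>"
    have "weight (unit_vector k i) \<alpha> = (\<Sum>j<n. W i j * Poly_Mapping.lookup \<alpha> j)" if "i < k" for i
    proof -
      have "weight (unit_vector k i) \<alpha> =
          (\<Sum>l<k. if l = i then \<Sum>j<n. W l j * Poly_Mapping.lookup \<alpha> j else 0)"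
        unfolding weight_swap by (intro sum.cong) (auto simp: unit_vector_def)
      then show ?thesis using that by simp
    qed
    then show "\<alpha> \<in> kernel_exponents p k n W"
      unfolding iff using * unit_vector_in_E by metis
  qed
qed

text \<open>
  The congruence conditions imposed by all group elements follow from those of the standard
  generators, and these are the rows of the kernel condition for the weight matrix.
\<close>

lemma invariant_ring_eq:
  "invariant_ring G n \<phi> = {f. Poly_Mapping.keys f \<subseteq> kernel_exponents p k n W}"
proof (rule Set.set_eqI)
  fix f
  have "f \<in> invariant_ring G n \<phi> \<longleftrightarrow> f \<in> poly_ring n \<and> (\<forall>v\<in>carrier E. \<phi> (h v) f = f)"
    unfolding invariant_ring_def carrier_G by blast
  also have "\<dots> \<longleftrightarrow> f \<in> poly_ring n \<and> (\<forall>\<alpha>\<in>Poly_Mapping.keys f. \<forall>v\<in>carrier E. p dvd weight v \<alpha>)"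
    using act_eq_self_iff by blast
  also have "\<dots> \<longleftrightarrow> f \<in> poly_ring n \<and> (\<forall>\<alpha>\<in>Poly_Mapping.keys f. \<alpha> \<in> kernel_exponents p k n W)"
    unfolding poly_ring_def using kernel_exponents_iff_weight by blast
  also have "\<dots> \<longleftrightarrow> f \<in> {f. Poly_Mapping.keys f \<subseteq> kernel_exponents p k n W}"
    unfolding poly_ring_def kernel_exponents_def by blast
  finally show "f \<in> invariant_ring G n \<phi> \<longleftrightarrow> f \<in> {f. Poly_Mapping.keys f \<subseteq> kernel_exponents p k n W}" .
qed

text \<open>
  A linear relation among the rows of the weight matrix gives the exponents of a product of
  standard generators that fixes every variable, and therefore the whole polynomial ring. With
  a trivial kernel this product is the identity, and all coefficients vanish modulo \<open>p\<close>.
\<close>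

lemma independent_rows_if_faithful:
  assumes faithful: "kernel G (BijGroup (poly_ring n)) \<phi> = {\<one>\<^bsub>G\<^esub>}"
  shows "independent_rows_mod p k n (\<lambda>i j. int (W i j))"
  unfolding independent_rows_mod_def
proof (intro allI impI)
  fix a :: "nat \<Rightarrow> int" and i
  assume a: "\<forall>j<n. [(\<Sum>i<k. a i * int (W i j)) = 0] (mod int p)" and i: "i < k"
  define v where "v = (\<lambda>i\<in>{..<k}. a i mod int p)"
  have v: "v \<in> carrier E"
    unfolding carrier_E using p_pos by (simp add: v_def)
  have "p dvd (\<Sum>i<k. nat (v i) * W i j)" if "j < n" for j
  proof -
    have "int (\<Sum>i<k. nat (v i) * W i j) = (\<Sum>i<k. (a i mod int p) * int (W i j))"
      using p_pos by (simp add: v_def)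
    also have "[\<dots> = (\<Sum>i<k. a i * int (W i j))] (mod int p)"
      by (intro cong_sum cong_mult) (auto simp: cong_def)
    also have "[(\<Sum>i<k. a i * int (W i j)) = 0] (mod int p)"
      using a that by blast
    finally show ?thesis
      by (simp only: cong_0_iff int_dvd_int_iff)
  qed
  then have "p dvd weight v \<alpha>" for \<alpha>
    unfolding weight_def by (intro dvd_sum) simp
  then have "\<phi> (h v) f = f" if "f \<in> poly_ring n" for f
    using act_eq_self_iff[OF v that] by blast
  moreover have "\<phi> (h v) \<in> extensional (poly_ring n)"
    using act.bij_prop0[OF h_in_G[OF v]] by (rule Bij_imp_extensional)
  ultimately have "\<phi> (h v) = (\<lambda>f\<in>poly_ring n. f)"
    by (auto simp: extensional_def restrict_def)
  then have "h v \<in> kernel G (BijGroup (poly_ring n)) \<phi>"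
    using h_in_G[OF v] by (simp add: kernel_def BijGroup_def)
  then have "h v = h \<one>\<^bsub>E\<^esub>"
    unfolding faithful h_one by simp
  moreover have "inj_on h (carrier E)"
    using iso by (simp only: iso_def bij_betw_def mem_Collect_eq)
  ultimately have "v = \<one>\<^bsub>E\<^esub>"
    using v group.is_monoid[OF group_E] by (meson inj_onD monoid.one_closed)
  then have "v i = 0"
    unfolding one_E using i by simp
  then show "[a i = 0] (mod int p)"
    using i by (simp add: v_def cong_def)
qed

end

theorem theorem1:
  fixes G :: "('g, 'b) monoid_scheme"
    and \<phi> :: "'g \<Rightarrow> cpoly \<Rightarrow> cpoly"
    and h :: "(nat \<Rightarrow> int) \<Rightarrow> 'g"
    and \<mu> :: complex
    and p k n :: nat
  assumes "prime p"
    and "k < n"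
    and "group G"
    and "h \<in> iso (elementary_group p k) G"
    and "primitive_root_of_unity p \<mu>"
    and "algebra_action G n \<phi>"
    and "linear_diagonal G n \<phi>"
    and "kernel G (BijGroup (poly_ring n)) \<phi> = {\<one>\<^bsub>G\<^esub>}"
  shows "\<exists>S. card S = n - k \<and>
             seed_invariants G p k n \<phi> (weight_matrix p k \<mu> h \<phi>) S \<and>
             (\<forall>M. minimal_monomial_generators G n \<phi> M \<longleftrightarrow> M = constructed_from_seeds p n S)"
proof -
  interpret elementary_diagonal_action G \<phi> h \<mu> p k n
    by (rule elementary_diagonal_action.intro) fact+
  have "0 < n" using assms(2) by simp
  then obtain S where S: "finite S" "card S = n - k" "S \<subseteq> kernel_exponents p k n W"
      "generates_kernel_mod p k n W S"
    using exists_exponents_generating_kernel_mod[OF assms(1) _ independent_rows_if_faithful[OF assms(8)]]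
    by blast
  have "mono_of ` S \<subseteq> invariant_ring G n \<phi>"
    unfolding invariant_ring_eq using S(3) by (auto simp: mono_of_def)
  then have "seed_invariants G p k n \<phi> W S"
    using S by (simp add: seed_invariants_def)
  moreover have "minimal_monomial_generators G n \<phi> M \<longleftrightarrow> M = constructed_from_seeds p n S" for M
    unfolding constructed_from_seeds_eq_atoms[OF S(4) p_pos]
    by (rule minimal_monomial_generators_iff[OF graded_submonoid_kernel_exponents invariant_ring_eq])
  ultimately show ?thesis
    using S(2) by blast
qed

end
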